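(* Let $d\ge 2$ and let $\Gamma=\{\gamma_1,\dots,\gamma_d\}$ be natural numbers with $1<\gamma_1<\gamma_2<\cdots<\gamma_d$ and $\gcd(\gamma_i,\gamma_j)=1$ for all $1\le i<j\le d$. Then the entropy of $\mathbb{X}_\Gamma^0$ is given by $$h(\mathbb{X}_\Gamma^0)=\sum_{k=1}^{\infty}\beta_\Gamma\left(\frac1{q_k}-\frac1{q_{k+1}}\right)\log|\Sigma_k|,$$ where $$\beta_\Gamma=\frac{\sharp\left(\mathcal{I}_\Gamma\cap[1,\gamma_1\gamma_2\cdots\gamma_d]\right)}{\gamma_1\gamma_2\cdots\gamma_d}.$$
   Context: $\mathbb{N}=\{1,2,3,\dots\}$. $\mathbb{X}_\Gamma^0=\{(x_1,x_2,\dots)\in\{0,1\}^{\mathbb{N}} : x_kx_{\gamma_1k}x_{\gamma_2k}\cdots x_{\gamma_dk}=0 \text{ for all } k\ge1\}$. Entropy: $h(\mathbb{X}_\Gamma^0)=\lim_{n\to\infty}\frac1n\log|X_{\Gamma;n}|$, where $X_{\Gamma;n}$ is the set of $(x_1,\dots,x_n)\in\{0,1\}^n$ with $x_kx_{\gamma_1k}\cdots x_{\gamma_dk}=0$ for all $k\ge1$ with $\gamma_dk\le n$ (part of the assertion is that the limit exists). $\mathbb{M}_\Gamma=\{\gamma_1^{m_1}\cdots\gamma_d^{m_d}: m_j\ge0\}=\{q_k\}_{k=1}^\infty$, listed in increasing order $q_1<q_2<\cdots$. $\mathcal{I}_\Gamma=\{n\in\mathbb{N}:\gamma_j\nmid n,\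 1\le j\le d\}$. $L_k=\{(i_1,\dots,i_d)\in\mathbb{Z}^d: i_1,\dots,i_d\ge0,\ \gamma_1^{i_1}\cdots\gamma_d^{i_d}\le q_k\}$. $\mathbb{L}_\Gamma=\{(i_1,\dots,i_d)\in\mathbb{Z}^d: i_j\ge0,\ 0\le i_1+\cdots+i_d\le1\}$ (the origin and the $d$ standard unit vectors). $\Sigma_k$ is the set of all admissible patterns on $L_k$, i.e. of all $U\in\{0,1\}^{L_k}$ such that for every $\mathbf v\in\mathbb{Z}^d$ with $\mathbb{L}_\Gamma+\mathbf v\subseteq L_k$, the restriction of $U$ to $\mathbb{L}_\Gamma+\mathbf v$ is not identically $1$. *)

theory Defs
  imports "HOL-Analysis.Analysis"
begin

text \<open>
  The tuple \<open>\<gamma>\<^sub>1, \<dots>, \<gamma>\<^sub>d\<close> is a function \<open>\<gamma> :: nat \<Rightarrow> nat\<close> of which only the values on \<open>{1..d}\<close>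
  are used; sequences and \<open>d\<close>-tuples likewise have indices starting at 1.
\<close>

definition mult_shift :: "nat \<Rightarrow> (nat \<Rightarrow> nat) \<Rightarrow> (nat \<Rightarrow> nat) set" where
  "mult_shift d \<gamma> =
     {x \<in> {1..} \<rightarrow>\<^sub>E {0, 1}. \<forall>k\<ge>1. x k * (\<Prod>j=1..d. x (\<gamma> j * k)) = 0}"

definition mult_words :: "nat \<Rightarrow> (nat \<Rightarrow> nat) \<Rightarrow> nat \<Rightarrow> (nat \<Rightarrow> nat) set" where
  "mult_words d \<gamma> n =
     {x \<in> {1..n} \<rightarrow>\<^sub>E {0, 1}.
        \<forall>k\<ge>1. \<gamma> d * k \<le> n \<longrightarrow> x k * (\<Prod>j=1..d. x (\<gamma> j * k)) = 0}"

definition entropy_seq :: "nat \<Rightarrow> (nat \<Rightarrow> nat) \<Rightarrow> nat \<Rightarrow> real" where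
  "entropy_seq d \<gamma> n = 1 / real n * ln (real (card (mult_words d \<gamma> n)))"

text \<open>Meaningful only together with convergence of \<^const>\<open>entropy_seq\<close>.\<close>

definition entropy :: "nat \<Rightarrow> (nat \<Rightarrow> nat) \<Rightarrow> real" where
  "entropy d \<gamma> = lim (entropy_seq d \<gamma>)"

definition mult_monoid :: "nat \<Rightarrow> (nat \<Rightarrow> nat) \<Rightarrow> nat set" where
  "mult_monoid d \<gamma> = {\<Prod>j=1..d. \<gamma> j ^ m j | m :: nat \<Rightarrow> nat. True}"

text \<open>
  \<^const>\<open>enumerate\<close> counts from 0, whereas \<open>q\<^sub>1 = 1\<close> is the least element of the monoid.
\<close>

definition q :: "nat \<Rightarrow> (nat \<Rightarrow> nat) \<Rightarrow> nat \<Rightarrow> nat" where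
  "q d \<gamma> k = enumerate (mult_monoid d \<gamma>) (k - 1)"

definition indep_set :: "nat \<Rightarrow> (nat \<Rightarrow> nat) \<Rightarrow> nat set" where
  "indep_set d \<gamma> = {n. n \<ge> 1 \<and> (\<forall>j\<in>{1..d}. \<not> \<gamma> j dvd n)}"

definition \<beta> :: "nat \<Rightarrow> (nat \<Rightarrow> nat) \<Rightarrow> real" where
  "\<beta> d \<gamma> = real (card (indep_set d \<gamma> \<inter> {1..\<Prod>j=1..d. \<gamma> j})) / real (\<Prod>j=1..d. \<gamma> j)"

definition Zd :: "nat \<Rightarrow> (nat \<Rightarrow> int) set" where
  "Zd d = {1..d} \<rightarrow>\<^sub>E UNIV"

definition translate :: "nat \<Rightarrow> (nat \<Rightarrow> int) \<Rightarrow> (nat \<Rightarrow> int) set \<Rightarrow> (nat \<Rightarrow> int) set" where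
  "translate d v S = (\<lambda>i. \<lambda>j\<in>{1..d}. i j + v j) ` S"

definition simplex_region :: "nat \<Rightarrow> (nat \<Rightarrow> nat) \<Rightarrow> nat \<Rightarrow> (nat \<Rightarrow> int) set" where
  "simplex_region d \<gamma> k =
     {i \<in> Zd d. (\<forall>j\<in>{1..d}. 0 \<le> i j) \<and> (\<Prod>j=1..d. \<gamma> j ^ nat (i j)) \<le> q d \<gamma> k}"

definition corner :: "nat \<Rightarrow> (nat \<Rightarrow> int) set" where
  "corner d = {i \<in> Zd d. (\<forall>j\<in>{1..d}. 0 \<le> i j) \<and> 0 \<le> (\<Sum>j=1..d. i j) \<and> (\<Sum>j=1..d. i j) \<le> 1}"

definition admissible_patterns ::
    "nat \<Rightarrow> (nat \<Rightarrow> nat) \<Rightarrow> nat \<Rightarrow> ((nat \<Rightarrow> int) \<Rightarrow> nat) set" where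
  "admissible_patterns d \<gamma> k =
     {U \<in> simplex_region d \<gamma> k \<rightarrow>\<^sub>E {0, 1}.
        \<forall>v\<in>Zd d. translate d v (corner d) \<subseteq> simplex_region d \<gamma> k \<longrightarrow>
          \<not> (\<forall>i\<in>translate d v (corner d). U i = 1)}"

text \<open>
  The finite words are exactly the initial segments of the points of the shift, so that
  \<^const>\<open>entropy\<close> is indeed an invariant of \<^const>\<open>mult_shift\<close>.
\<close>

lemma mult_words_eq_restrict_mult_shift:
  assumes "d \<ge> 1" and "\<And>j. j \<in> {1..d} \<Longrightarrow> 1 \<le> \<gamma> j \<and> \<gamma> j \<le> \<gamma> d"
  shows "mult_words d \<gamma> n = (\<lambda>x. restrict x {1..n}) ` mult_shift d \<gamma>"
proof (intro equalityI subsetI)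
  fix x assume x: "x \<in> mult_words d \<gamma> n"
  define y where "y = (\<lambda>k\<in>{1..}. if k \<le> n then x k else 0)"
  have x01: "x \<in> {1..n} \<rightarrow>\<^sub>E {0, 1}"
    and x0: "\<And>k. k \<ge> 1 \<Longrightarrow> \<gamma> d * k \<le> n \<Longrightarrow> x k * (\<Prod>j=1..d. x (\<gamma> j * k)) = 0"
    using x by (auto simp: mult_words_def)
  have y_eq: "y i = x i" if "1 \<le> i" "i \<le> n" for i
    using that by (simp add: y_def)
  have "y k * (\<Prod>j=1..d. y (\<gamma> j * k)) = 0" if k: "k \<ge> 1" for k
  proof (cases "\<gamma> d * k \<le> n")
    case True
    have *: "1 \<le> \<gamma> j * k" "\<gamma> j * k \<le> n" if "j \<in> {1..d}" for j
    proof -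
      show "1 \<le> \<gamma> j * k" using assms(2)[OF that] k by (simp add: Suc_leI)
      have "\<gamma> j * k \<le> \<gamma> d * k" using assms(2)[OF that] by simp
      then show "\<gamma> j * k \<le> n" using True by linarith
    qed
    have "1 * k \<le> \<gamma> d * k" using assms(2)[of d] assms(1) by (intro mult_right_mono) auto
    then have "k \<le> n" using True by linarith
    then have "y k = x k" using k by (intro y_eq) auto
    moreover have "(\<Prod>j=1..d. y (\<gamma> j * k)) = (\<Prod>j=1..d. x (\<gamma> j * k))"
      using * by (intro prod.cong refl y_eq) auto
    ultimately show ?thesis using x0[OF k True] by simp
  next
    case False
    then have "\<gamma> d * k \<in> {1..}" unfolding atLeast_iff by linarith
    then have "y (\<gamma> d * k) = 0" using False unfolding y_def by (simp only: restrict_apply' if_False)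
    then have "(\<Prod>j=1..d. y (\<gamma> j * k)) = 0" using assms(1) by (intro prod_zero bexI[of _ d]) auto
    then show ?thesis by simp
  qed
  moreover have "y \<in> {1..} \<rightarrow>\<^sub>E {0, 1}"
    using x01 by (auto simp: y_def PiE_iff)
  ultimately have "y \<in> mult_shift d \<gamma>" by (simp add: mult_shift_def)
  moreover have "x = restrict y {1..n}"
    using x01 by (auto simp: y_def fun_eq_iff PiE_iff extensional_def)
  ultimately show "x \<in> (\<lambda>x. restrict x {1..n}) ` mult_shift d \<gamma>" by blast
next
  fix x assume "x \<in> (\<lambda>x. restrict x {1..n}) ` mult_shift d \<gamma>"
  then obtain y where y: "y \<in> mult_shift d \<gamma>" and xy: "x = restrict y {1..n}" by blast
  have y01: "y \<in> {1..} \<rightarrow>\<^sub>E {0, 1}"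
    and y0: "\<And>k. k \<ge> 1 \<Longrightarrow> y k * (\<Prod>j=1..d. y (\<gamma> j * k)) = 0"
    using y by (auto simp: mult_shift_def)
  have "x k * (\<Prod>j=1..d. x (\<gamma> j * k)) = 0" if k: "k \<ge> 1" and le: "\<gamma> d * k \<le> n" for k
  proof -
    have *: "1 \<le> \<gamma> j * k" "\<gamma> j * k \<le> n" if "j \<in> {1..d}" for j
    proof -
      show "1 \<le> \<gamma> j * k" using assms(2)[OF that] k by (simp add: Suc_leI)
      have "\<gamma> j * k \<le> \<gamma> d * k" using assms(2)[OF that] by simp
      then show "\<gamma> j * k \<le> n" using le by linarith
    qed
    have "1 * k \<le> \<gamma> d * k" using assms(2)[of d] assms(1) by (intro mult_right_mono) auto
    then have "k \<le> n" using le by linarith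
    then have "x k = y k" using k by (simp add: xy)
    moreover have "(\<Prod>j=1..d. x (\<gamma> j * k)) = (\<Prod>j=1..d. y (\<gamma> j * k))"
      using * by (intro prod.cong refl) (auto simp: xy)
    ultimately show ?thesis using y0[OF k] by simp
  qed
  moreover have "x \<in> {1..n} \<rightarrow>\<^sub>E {0, 1}"
    using y01 by (auto simp: xy PiE_iff)
  ultimately show "x \<in> mult_words d \<gamma> n" by (simp add: mult_words_def)
qed

end

theory Submission
  imports Defs
begin

text \<open>
  Since the \<open>\<gamma>\<^sub>j\<close> are pairwise coprime, every positive integer is uniquely \<open>i * m\<close> with
  \<open>i \<in> I\<close> (no \<open>\<gamma>\<^sub>j\<close> divides \<open>i\<close>) and \<open>m \<in> M\<close>, the monoid generated by the \<open>\<gamma>\<^sub>j\<close>. The constraints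
  never mix different \<open>i\<close>, so the words of length \<open>n\<close> are a product over \<open>i \<in> I\<close>, \<open>i \<le> n\<close>, of
  words on \<open>M \<inter> [1, n / i]\<close>. Let \<open>a(N)\<close> be the logarithm of the number of words on \<open>M \<inter> [1, N]\<close> and
  \<open>b(N) = a(N) - a(N - 1)\<close>; then \<open>0 \<le> b(N) \<le> ln 2\<close>, and \<open>b(N) = 0\<close> off \<open>M\<close>. Exchanging sums,
  \<open>1/n * ln |X\<^sub>n| = \<Sum>\<^sub>N b(N) * |I \<inter> [1, n / N]| / n\<close>. The set \<open>I\<close> is periodic of density \<open>\<beta>\<close> and
  \<open>\<Sum>\<^bsub>m \<in> M\<^esub> 1 / m\<close> converges, so dominated convergence for series gives the limit
  \<open>\<beta> * \<Sum>\<^sub>N b(N) / N\<close>, and summation by parts along the enumeration of \<open>M\<close> turns this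
  into the stated series.
\<close>

section \<open>Square roots of products and transport of function spaces along a bijection\<close>

lemma real_sqrt_prod: "sqrt (\<Prod>x\<in>A. f x) = (\<Prod>x\<in>A. sqrt (f x))"
  by (induction A rule: infinite_finite_induct) (simp_all add: real_sqrt_mult)

text \<open>Composing with the inverse of \<open>f\<close> undoes the map. This will carry words on
  the monoid to patterns on the lattice.\<close>

lemma bij_betw_PiE_compose:
  assumes "bij_betw f A B"
  shows "bij_betw (\<lambda>y. \<lambda>a\<in>A. y (f a)) (B \<rightarrow>\<^sub>E C) (A \<rightarrow>\<^sub>E C)"
proof -
  define g where "g = inv_into A f"
  have g: "g b \<in> A" "f (g b) = b" if "b \<in> B" for b
    using assms that by (auto simp: g_def bij_betw_def inv_into_into f_inv_into_f)
  have f: "f a \<in> B" "g (f a) = a" if "a \<in> A" for a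
    using assms that by (auto simp: g_def bij_betw_def)
  show ?thesis
    by (rule bij_betw_byWitness[where f' = "\<lambda>u. \<lambda>b\<in>B. u (g b)"])
      (use f g in \<open>auto simp: PiE_iff fun_eq_iff extensional_def\<close>)
qed

subsection \<open>Translates of the corner\<close>

definition increment :: "nat \<Rightarrow> (nat \<Rightarrow> int) \<Rightarrow> nat \<Rightarrow> nat \<Rightarrow> int" where
  "increment d v j = (\<lambda>i\<in>{1..d}. v i + of_bool (i = j))"

text \<open>In a nonnegative integer vector with sum at most 1, a nonzero coordinate already
  exhausts the sum.\<close>

lemma corner_eq:
  "corner d = insert (\<lambda>i\<in>{1..d}. 0) ((\<lambda>j. \<lambda>i\<in>{1..d}. of_bool (i = j)) ` {1..d})"
proof (intro equalityI subsetI)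
  fix u assume "u \<in> corner d"
  then have u: "u \<in> extensional {1..d}" and nonneg: "\<And>j. j \<in> {1..d} \<Longrightarrow> 0 \<le> u j"
    and le: "(\<Sum>j=1..d. u j) \<le> 1"
    by (auto simp: corner_def Zd_def PiE_def)
  show "u \<in> insert (\<lambda>i\<in>{1..d}. 0) ((\<lambda>j. \<lambda>i\<in>{1..d}. of_bool (i = j)) ` {1..d})"
  proof (cases "\<forall>j\<in>{1..d}. u j = 0")
    case True
    then have "u = (\<lambda>i\<in>{1..d}. 0)"
      using u by (intro extensionalityI[of _ "{1..d}"]) auto
    then show ?thesis by blast
  next
    case False
    then obtain j where j: "j \<in> {1..d}" "u j \<noteq> 0" by blast
    have split: "(\<Sum>j=1..d. u j) = u j + sum u ({1..d} - {j})"
      using j(1) by (intro sum.remove) auto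
    have rest: "0 \<le> sum u ({1..d} - {j})"
      by (intro sum_nonneg nonneg) auto
    have "u j = 1" "sum u ({1..d} - {j}) = 0"
      using split rest le j nonneg[OF j(1)] by linarith+
    moreover from this have "u i = 0" if "i \<in> {1..d} - {j}" for i
      using sum_nonneg_eq_0_iff[of "{1..d} - {j}" u] nonneg that by (auto simp del: One_nat_def)
    ultimately have "u = (\<lambda>i\<in>{1..d}. of_bool (i = j))"
      using u by (intro extensionalityI[of _ "{1..d}"]) auto
    then show ?thesis
      using j(1) by blast
  qed
next
  fix u :: "nat \<Rightarrow> int"
  assume "u \<in> insert (\<lambda>i\<in>{1..d}. 0) ((\<lambda>j. \<lambda>i\<in>{1..d}. of_bool (i = j)) ` {1..d})"
  then show "u \<in> corner d"
    by (auto simp: corner_def Zd_def)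
qed

text \<open>This gives the geometric condition the shape of the multiplicative one: \<open>v\<close>
  and its \<open>d\<close> increments will correspond to \<open>m\<close> and the multiples
  \<open>\<gamma> j * m\<close>.\<close>

lemma translate_corner:
  assumes "v \<in> Zd d"
  shows "translate d v (corner d) = insert v (increment d v ` {1..d})"
proof -
  have "(\<lambda>j\<in>{1..d}. (\<lambda>i\<in>{1..d}. 0) j + v j) = v"
    using assms by (auto simp: Zd_def PiE_iff extensional_def fun_eq_iff)
  moreover have "(\<lambda>l\<in>{1..d}. (\<lambda>i\<in>{1..d}. of_bool (i = j)) l + v l) = increment d v j" for j
    by (auto simp: increment_def fun_eq_iff)
  ultimately show ?thesis
    unfolding translate_def corner_eq image_insert image_image by simp
qed

subsection \<open>Unique factorization\<close>

text \<open>\<open>base_le_last\<close> ensures that a constraint at \<open>k\<close> with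
  \<open>\<gamma> d * k \<le> n\<close> has all its points \<open>\<gamma> j * k\<close> inside the
  window.\<close>

locale coprime_bases =
  fixes d :: nat and \<gamma> :: "nat \<Rightarrow> nat"
  assumes d_pos: "1 \<le> d"
    and base_gt_1: "j \<in> {1..d} \<Longrightarrow> 1 < \<gamma> j"
    and base_le_last: "j \<in> {1..d} \<Longrightarrow> \<gamma> j \<le> \<gamma> d"
    and coprime_base: "i \<in> {1..d} \<Longrightarrow> j \<in> {1..d} \<Longrightarrow> i \<noteq> j \<Longrightarrow> coprime (\<gamma> i) (\<gamma> j)"
begin

abbreviation M :: "nat set" where "M \<equiv> mult_monoid d \<gamma>"
abbreviation I :: "nat set" where "I \<equiv> indep_set d \<gamma>"

lemma last_base_gt_1: "1 < \<gamma> d"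
  using base_gt_1[of d] d_pos by simp

lemma one_in_monoid: "1 \<in> M"
  unfolding mult_monoid_def by (auto intro!: exI[of _ "\<lambda>_. 0"])

lemma prod_powers_in_monoid: "(\<Prod>j=1..d. \<gamma> j ^ m j) \<in> M"
  unfolding mult_monoid_def by blast

lemma prod_powers_increment:
  assumes "j \<in> {1..d}"
  shows "(\<Prod>i=1..d. \<gamma> i ^ (m i + of_bool (i = j))) = \<gamma> j * (\<Prod>i=1..d. \<gamma> i ^ m i)"
proof -
  have "(\<Prod>i=1..d. \<gamma> i ^ of_bool (i = j)) = (\<Prod>i=1..d. if i = j then \<gamma> i else 1)"
    by (intro prod.cong) auto
  also have "\<dots> = \<gamma> j"
    using assms by simp
  finally show ?thesis
    by (simp add: power_add prod.distrib)
qed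

lemma base_mult_in_monoid:
  assumes "j \<in> {1..d}" "m \<in> M"
  shows "\<gamma> j * m \<in> M"
proof -
  obtain e where "m = (\<Prod>i=1..d. \<gamma> i ^ e i)"
    using assms(2) unfolding mult_monoid_def by blast
  then show ?thesis
    using prod_powers_increment[OF assms(1), of e] prod_powers_in_monoid by metis
qed

lemma monoid_pos: "m \<in> M \<Longrightarrow> 0 < m"
  unfolding mult_monoid_def using base_gt_1 by (fastforce intro!: prod_pos)

lemma infinite_monoid: "infinite M"
proof -
  have "\<gamma> d ^ n \<in> M" for n
    using d_pos by (induction n) (auto intro: one_in_monoid[simplified] base_mult_in_monoid)
  then have "range (\<lambda>n. \<gamma> d ^ n) \<subseteq> M"
    by blast
  moreover have "inj (\<lambda>n. \<gamma> d ^ n)"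
    using last_base_gt_1 by (intro injI) simp
  ultimately show ?thesis
    using finite_subset range_inj_infinite by blast
qed

text \<open>The bases may be composite, so exponents are read off with respect to
  \<open>\<gamma> j\<close> itself: once \<open>\<gamma> j ^ m j\<close> is cancelled, a further
  factor \<open>\<gamma> j\<close> is coprime to the other powers and would have to divide
  \<open>i\<close>.\<close>

lemma multiplicity_base:
  assumes i: "i \<in> I" and j: "j \<in> {1..d}"
  shows "multiplicity (\<gamma> j) (i * (\<Prod>l=1..d. \<gamma> l ^ m l)) = m j"
proof (rule multiplicity_eqI)
  let ?c = "\<Prod>l\<in>{1..d}-{j}. \<gamma> l ^ m l"
  have split: "(\<Prod>l=1..d. \<gamma> l ^ m l) = \<gamma> j ^ m j * ?c"
    using j by (intro prod.remove) auto
  show "\<gamma> j ^ m j dvd i * (\<Prod>l=1..d. \<gamma> l ^ m l)"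
    unfolding split by simp
  show "\<not> \<gamma> j ^ Suc (m j) dvd i * (\<Prod>l=1..d. \<gamma> l ^ m l)"
  proof
    assume "\<gamma> j ^ Suc (m j) dvd i * (\<Prod>l=1..d. \<gamma> l ^ m l)"
    then have "\<gamma> j ^ m j * \<gamma> j dvd \<gamma> j ^ m j * (i * ?c)"
      unfolding split by (simp add: ac_simps)
    then have "\<gamma> j dvd i * ?c"
      using base_gt_1[OF j] by simp
    moreover have "coprime (\<gamma> j) ?c"
      using j coprime_base by (intro prod_coprime_right) auto
    ultimately have "\<gamma> j dvd i"
      by (simp add: coprime_dvd_mult_left_iff)
    then show False
      using i j by (auto simp: indep_set_def)
  qed
qed

text \<open>\<open>multiplicity_base\<close> recovers every exponent from the common product, so the
  monoid factors agree and can be cancelled.\<close>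

lemma factorization_unique:
  assumes "i \<in> I" "i' \<in> I" "m \<in> M" "m' \<in> M" "i * m = i' * m'"
  shows "i = i'" "m = m'"
proof -
  obtain e where e: "m = (\<Prod>j=1..d. \<gamma> j ^ e j)"
    using assms unfolding mult_monoid_def by blast
  obtain e' where e': "m' = (\<Prod>j=1..d. \<gamma> j ^ e' j)"
    using assms unfolding mult_monoid_def by blast
  have "e j = e' j" if "j \<in> {1..d}" for j
    using multiplicity_base[OF assms(1) that, of e] multiplicity_base[OF assms(2) that, of e'] assms(5)
    by (simp add: e e')
  then show "m = m'"
    unfolding e e' by (intro prod.cong) auto
  then show "i = i'"
    using assms(5) monoid_pos[OF assms(3)] by simp
qed

lemma one_in_indep: "1 \<in> I"
  using base_gt_1 by (fastforce simp: indep_set_def)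

lemma prod_powers_inj:
  assumes "(\<Prod>j=1..d. \<gamma> j ^ e j) = (\<Prod>j=1..d. \<gamma> j ^ e' j)" "j \<in> {1..d}"
  shows "e j = e' j"
  using multiplicity_base[OF one_in_indep assms(2), of e]
    multiplicity_base[OF one_in_indep assms(2), of e'] assms(1) by simp

text \<open>Bases are split off one at a time; the quotients decrease until no base divides.\<close>

lemma factorization_exists:
  assumes "0 < k"
  shows "\<exists>i\<in>I. \<exists>m\<in>M. k = i * m"
  using assms
proof (induction k rule: less_induct)
  case (less k)
  show ?case
  proof (cases "k \<in> I")
    case True
    then show ?thesis
      using one_in_monoid by (intro bexI[of _ k] bexI[of _ 1]) auto
  next
    case False
    then obtain j k' where j: "j \<in> {1..d}" and k': "k = \<gamma> j * k'"
      using less.prems by (auto simp: indep_set_def)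
    have "k' < k" "0 < k'"
      using base_gt_1[OF j] less.prems k' by auto
    then obtain i m where "i \<in> I" "m \<in> M" "k' = i * m"
      using less.IH by blast
    then show ?thesis
      using base_mult_in_monoid[OF j] k' by (intro bexI[of _ i] bexI[of _ "\<gamma> j * m"]) auto
  qed
qed

text \<open>By \<open>factorization_unique\<close> only one value is eligible for positive
  \<open>k\<close>, so the choice is canonical.\<close>

definition indep_part :: "nat \<Rightarrow> nat" where
  "indep_part k = (SOME i. i \<in> I \<and> (\<exists>m\<in>M. k = i * m))"

definition monoid_part :: "nat \<Rightarrow> nat" where
  "monoid_part k = k div indep_part k"

lemma indep_pos: "i \<in> I \<Longrightarrow> 0 < i"
  by (simp add: indep_set_def)

lemma parts:
  assumes "0 < k"
  shows "indep_part k \<in> I" "monoid_part k \<in> M" "indep_part k * monoid_part k = k"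
proof -
  have *: "indep_part k \<in> I \<and> (\<exists>m\<in>M. k = indep_part k * m)"
    unfolding indep_part_def by (rule someI_ex) (use factorization_exists[OF assms] in blast)
  then obtain m where "m \<in> M" "k = indep_part k * m"
    by blast
  moreover from this have "monoid_part k = m"
    unfolding monoid_part_def using assms
    by (metis nonzero_mult_div_cancel_left mult_0 less_not_refl)
  ultimately show "indep_part k \<in> I" "monoid_part k \<in> M" "indep_part k * monoid_part k = k"
    using * by auto
qed

lemma parts_mult:
  assumes "i \<in> I" "m \<in> M"
  shows "indep_part (i * m) = i" "monoid_part (i * m) = m"
proof -
  have "0 < i * m"
    using assms indep_pos monoid_pos by simp
  from factorization_unique[OF parts(1)[OF this] assms(1) parts(2)[OF this] assms(2) parts(3)[OF this]]
  show "indep_part (i * m) = i" "monoid_part (i * m) = m" by auto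
qed

subsection \<open>Words on the monoid\<close>

definition monoid_words :: "nat \<Rightarrow> (nat \<Rightarrow> nat) set" where
  "monoid_words N =
     {y \<in> M \<inter> {1..N} \<rightarrow>\<^sub>E {0, 1}. \<forall>m\<in>M. \<gamma> d * m \<le> N \<longrightarrow> y m * (\<Prod>j=1..d. y (\<gamma> j * m)) = 0}"

lemma finite_monoid_words: "finite (monoid_words N)"
  unfolding monoid_words_def
  by (rule finite_subset[of _ "M \<inter> {1..N} \<rightarrow>\<^sub>E {0, 1}"]) (auto intro: finite_PiE)

lemma base_mult_le:
  assumes "j \<in> {1..d}" "\<gamma> d * m \<le> N"
  shows "\<gamma> j * m \<le> N" "m \<le> N"
proof -
  have "\<gamma> j * m \<le> \<gamma> d * m" "1 * m \<le> \<gamma> d * m"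
    using base_le_last[OF assms(1)] last_base_gt_1 by (intro mult_right_mono; simp)+
  then show "\<gamma> j * m \<le> N" "m \<le> N"
    using assms(2) by linarith+
qed

text \<open>A word splits into rows, row \<open>i\<close> holding the letters at the points
  \<open>i * m\<close> with \<open>m\<close> in the monoid and \<open>m \<le> n div i\<close>. Every
  constraint stays within one row, so the rows can be chosen independently.\<close>

lemma card_mult_words:
  "card (mult_words d \<gamma> n) = (\<Prod>i\<in>I \<inter> {1..n}. card (monoid_words (n div i)))"
proof -
  \<comment> \<open>\<open>?F\<close> cuts a word into its rows; \<open>?G\<close> reassembles them
    by looking up each \<open>k\<close> in the row of its independent part.\<close>
  let ?F = "\<lambda>x. \<lambda>i\<in>I \<inter> {1..n}. \<lambda>m\<in>M \<inter> {1..n div i}. x (i * m)"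
  let ?G = "\<lambda>y. \<lambda>k\<in>{1..n}. y (indep_part k) (monoid_part k)"
  let ?P = "\<Pi>\<^sub>E i\<in>I \<inter> {1..n}. monoid_words (n div i)"
  have le_iff: "m \<le> n div i \<longleftrightarrow> i * m \<le> n" if "i \<in> I" for i m
    using indep_pos[OF that] by (simp add: less_eq_div_iff_mult_less_eq mult.commute)
  have parts_le: "indep_part k \<in> I \<inter> {1..n}" "monoid_part k \<in> M \<inter> {1..n div indep_part k}"
    if "k \<in> {1..n}" for k
  proof -
    have k: "0 < k" "k \<le> n"
      using that by auto
    note p = parts[OF k(1)]
    have "indep_part k * 1 \<le> indep_part k * monoid_part k"
      using monoid_pos[OF p(2)] by (intro mult_left_mono) auto
    then show "indep_part k \<in> I \<inter> {1..n}"
      using p k indep_pos[OF p(1)] by auto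
    show "monoid_part k \<in> M \<inter> {1..n div indep_part k}"
      using p k monoid_pos[OF p(2)] le_iff[OF p(1)] by auto
  qed
  have mult_in: "i * m \<in> {1..n}" if "i \<in> I" "m \<in> M" "m \<le> n div i" for i m
    using that indep_pos[OF that(1)] monoid_pos[OF that(2)] le_iff[OF that(1)] by auto
  have "bij_betw ?F (mult_words d \<gamma> n) ?P"
  proof (rule bij_betw_byWitness[where f' = ?G])
    show "\<forall>x\<in>mult_words d \<gamma> n. ?G (?F x) = x"
    proof
      fix x assume "x \<in> mult_words d \<gamma> n"
      then have x: "x \<in> {1..n} \<rightarrow>\<^sub>E {0, 1}"
        by (simp add: mult_words_def)
      show "?G (?F x) = x"
      proof
        fix k
        show "?G (?F x) k = x k"
        proof (cases "k \<in> {1..n}")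
          case True
          then show ?thesis
            using parts_le[OF True] parts(3)[of k] by simp
        next
          case False
          then show ?thesis
            using x by (auto simp: PiE_iff extensional_def)
        qed
      qed
    qed
    show "\<forall>y\<in>?P. ?F (?G y) = y"
    proof
      fix y assume y: "y \<in> ?P"
      show "?F (?G y) = y"
      proof
        fix i
        show "?F (?G y) i = y i"
        proof (cases "i \<in> I \<inter> {1..n}")
          case True
          have "y i \<in> M \<inter> {1..n div i} \<rightarrow>\<^sub>E {0, 1}"
            using y True by (auto simp: PiE_iff monoid_words_def)
          then have "(\<lambda>m\<in>M \<inter> {1..n div i}. y i m) = y i"
            by (intro restrict_PiE_iff[THEN iffD2] extensional_restrict) (simp add: PiE_iff)
          moreover have "?F (?G y) i = (\<lambda>m\<in>M \<inter> {1..n div i}. y i m)"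
            using True mult_in parts_mult by (auto intro!: restrict_ext)
          ultimately show ?thesis by simp
        next
          case False
          then show ?thesis
            using y by (auto simp: PiE_iff extensional_def)
        qed
      qed
    qed
    show "?F ` mult_words d \<gamma> n \<subseteq> ?P"
    proof
      fix y assume "y \<in> ?F ` mult_words d \<gamma> n"
      then obtain x where x: "x \<in> mult_words d \<gamma> n" and y: "y = ?F x" by blast
      have x01: "x \<in> {1..n} \<rightarrow>\<^sub>E {0, 1}"
        and x0: "\<And>k. k \<ge> 1 \<Longrightarrow> \<gamma> d * k \<le> n \<Longrightarrow> x k * (\<Prod>j=1..d. x (\<gamma> j * k)) = 0"
        using x by (auto simp: mult_words_def)
      have "y i \<in> monoid_words (n div i)" if i: "i \<in> I \<inter> {1..n}" for i
      proof -
        have yi: "y i = (\<lambda>m\<in>M \<inter> {1..n div i}. x (i * m))"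
          using i by (simp add: y)
        have "y i \<in> M \<inter> {1..n div i} \<rightarrow>\<^sub>E {0, 1}"
        proof (rule PiE_I)
          fix m assume m: "m \<in> M \<inter> {1..n div i}"
          then have "x (i * m) \<in> {0, 1}"
            using i by (intro PiE_mem[OF x01] mult_in) auto
          then show "y i m \<in> {0, 1}"
            using m by (simp add: yi)
        qed (auto simp: yi)
        moreover have "y i m * (\<Prod>j=1..d. y i (\<gamma> j * m)) = 0" if m: "m \<in> M" "\<gamma> d * m \<le> n div i" for m
        proof -
          \<comment> \<open>The constraint of row \<open>i\<close> at \<open>m\<close> is that of
            \<open>x\<close> at \<open>i * m\<close>, and both are active under the same
            condition.\<close>
          have "\<gamma> d * (i * m) \<le> n"
            using m le_iff[of i] i by (simp add: ac_simps)
          moreover have "1 \<le> i * m"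
            using indep_pos[of i] monoid_pos[OF m(1)] i by simp
          ultimately have "x (i * m) * (\<Prod>j=1..d. x (\<gamma> j * (i * m))) = 0"
            by (intro x0)
          moreover have "y i m = x (i * m)"
            using m base_mult_le(2)[of d m] d_pos monoid_pos[OF m(1)] by (simp add: yi)
          moreover have "(\<Prod>j=1..d. y i (\<gamma> j * m)) = (\<Prod>j=1..d. x (\<gamma> j * (i * m)))"
          proof (intro prod.cong refl)
            fix j assume j: "j \<in> {1..d}"
            show "y i (\<gamma> j * m) = x (\<gamma> j * (i * m))"
              using base_mult_le(1)[OF j m(2)] base_mult_in_monoid[OF j m(1)]
                monoid_pos[OF base_mult_in_monoid[OF j m(1)]]
              by (simp add: yi ac_simps)
          qed
          ultimately show ?thesis by simp
        qed
        ultimately show ?thesis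
          by (simp add: monoid_words_def)
      qed
      then show "y \<in> ?P"
        unfolding y by (simp add: PiE_iff)
    qed
    show "?G ` ?P \<subseteq> mult_words d \<gamma> n"
    proof
      fix x assume "x \<in> ?G ` ?P"
      then obtain y where y: "y \<in> ?P" and x: "x = ?G y" by blast
      have yi: "y i \<in> monoid_words (n div i)" if "i \<in> I \<inter> {1..n}" for i
        using y that by (auto simp: PiE_iff)
      have "x \<in> {1..n} \<rightarrow>\<^sub>E {0, 1}"
      proof (rule PiE_I)
        fix k assume k: "k \<in> {1..n}"
        have "y (indep_part k) \<in> M \<inter> {1..n div indep_part k} \<rightarrow>\<^sub>E {0, 1}"
          using yi[OF parts_le(1)[OF k]] by (simp add: monoid_words_def)
        then have "y (indep_part k) (monoid_part k) \<in> {0, 1}"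
          using parts_le(2)[OF k] by (rule PiE_mem)
        then show "x k \<in> {0, 1}"
          using k by (simp add: x)
      qed (auto simp: x)
      moreover have "x k * (\<Prod>j=1..d. x (\<gamma> j * k)) = 0" if k: "k \<ge> 1" "\<gamma> d * k \<le> n" for k
      proof -
        define i m where "i = indep_part k" and "m = monoid_part k"
        have im: "i \<in> I" "m \<in> M" "k = i * m"
          using parts[of k] k by (auto simp: i_def m_def)
        have kn: "k \<in> {1..n}"
          using base_mult_le(2)[of d k n] d_pos k by simp
        have i: "i \<in> I \<inter> {1..n}"
          using parts_le(1)[OF kn] by (simp add: i_def)
        have "\<gamma> d * m \<le> n div i"
          using k(2) le_iff[OF im(1)] im(3) by (simp add: ac_simps)
        then have "y i m * (\<Prod>j=1..d. y i (\<gamma> j * m)) = 0"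
          using yi[OF i] im(2) by (simp add: monoid_words_def)
        moreover have "x k = y i m"
          using kn by (simp add: x i_def m_def)
        moreover have "(\<Prod>j=1..d. x (\<gamma> j * k)) = (\<Prod>j=1..d. y i (\<gamma> j * m))"
        proof (intro prod.cong refl)
          fix j assume j: "j \<in> {1..d}"
          \<comment> \<open>Multiplication by a base changes only the monoid part, so all points of
            the constraint lie in row \<open>i\<close>.\<close>
          have "\<gamma> j * k = i * (\<gamma> j * m)"
            using im by simp
          then have "indep_part (\<gamma> j * k) = i" "monoid_part (\<gamma> j * k) = \<gamma> j * m"
            using parts_mult[OF im(1) base_mult_in_monoid[OF j im(2)]] by metis+
          moreover have "\<gamma> j * k \<in> {1..n}"
            using base_mult_le(1)[OF j k(2)] k(1) base_gt_1[OF j] by simp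
          ultimately show "x (\<gamma> j * k) = y i (\<gamma> j * m)"
            by (simp add: x)
        qed
        ultimately show ?thesis by simp
      qed
      ultimately show "x \<in> mult_words d \<gamma> n"
        by (simp add: mult_words_def)
    qed
  qed
  then have "card (mult_words d \<gamma> n) = card ?P"
    by (rule bij_betw_same_card)
  then show ?thesis
    by (simp add: card_PiE)
qed

section \<open>Growth of the number of words when the window gains one point\<close>

lemma monoid_words_0: "monoid_words 0 = {\<lambda>_. undefined}"
proof -
  have "\<not> \<gamma> d * m \<le> 0" if "m \<in> M" for m
    using monoid_pos[OF that] last_base_gt_1 by simp
  then show ?thesis
    by (auto simp: monoid_words_def simp del: le_zero_eq)
qed

text \<open>Besides the window, the set of active constraints is unchanged too:
  \<open>\<gamma> d * m\<close> lies in the monoid and so cannot equal \<open>Suc N\<close>.\<close>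

lemma monoid_words_Suc_notin:
  assumes "Suc N \<notin> M"
  shows "monoid_words (Suc N) = monoid_words N"
proof -
  have "M \<inter> {1..Suc N} = M \<inter> {1..N}"
    using assms by (auto simp: le_Suc_eq)
  moreover have "\<gamma> d * m \<le> Suc N \<longleftrightarrow> \<gamma> d * m \<le> N" if "m \<in> M" for m
    using base_mult_in_monoid[OF _ that, of d] d_pos assms by (auto simp: le_Suc_eq)
  ultimately show ?thesis
    unfolding monoid_words_def by auto
qed

text \<open>Appending the letter 0 is always allowed: a constraint that becomes active has
  \<open>\<gamma> d * m = Suc N\<close> and is satisfied by the new 0.\<close>

lemma card_monoid_words_Suc_ge:
  assumes "Suc N \<in> M"
  shows "card (monoid_words N) \<le> card (monoid_words (Suc N))"
proof (rule card_inj_on_le[where f = "\<lambda>y. y(Suc N := 0)"])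
  have ins: "M \<inter> {1..Suc N} = insert (Suc N) (M \<inter> {1..N})"
    using assms by (auto simp: le_Suc_eq)
  show "inj_on (\<lambda>y. y(Suc N := 0)) (monoid_words N)"
  proof (rule inj_onI)
    fix y z assume yz: "y \<in> monoid_words N" "z \<in> monoid_words N" and eq: "y(Suc N := 0) = z(Suc N := 0)"
    \<comment> \<open>Both words have the same default value at \<open>Suc N\<close>, so overwriting
      it loses no information.\<close>
    have "y (Suc N) = undefined" "z (Suc N) = undefined"
      using yz by (auto simp: monoid_words_def PiE_iff extensional_def)
    then show "y = z"
      using eq by (metis fun_upd_triv fun_upd_upd)
  qed
  show "(\<lambda>y. y(Suc N := 0)) ` monoid_words N \<subseteq> monoid_words (Suc N)"
  proof
    fix z assume "z \<in> (\<lambda>y. y(Suc N := 0)) ` monoid_words N"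
    then obtain y where y: "y \<in> monoid_words N" and z: "z = y(Suc N := 0)" by blast
    have "z \<in> M \<inter> {1..Suc N} \<rightarrow>\<^sub>E {0, 1}"
      unfolding ins z using y by (auto simp: monoid_words_def PiE_iff extensional_def)
    moreover have "z m * (\<Prod>j=1..d. z (\<gamma> j * m)) = 0" if m: "m \<in> M" "\<gamma> d * m \<le> Suc N" for m
    proof (cases "\<gamma> d * m = Suc N")
      case True
      then have "(\<Prod>j=1..d. z (\<gamma> j * m)) = 0"
        using d_pos by (intro prod_zero bexI[of _ d]) (auto simp: z)
      then show ?thesis by simp
    next
      case False
      then have le: "\<gamma> d * m \<le> N"
        using m(2) by simp
      have "z m = y m"
        using base_mult_le(2)[OF _ le, of d] d_pos by (simp add: z)
      moreover have "(\<Prod>j=1..d. z (\<gamma> j * m)) = (\<Prod>j=1..d. y (\<gamma> j * m))"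
        using base_mult_le(1)[OF _ le] by (intro prod.cong refl) (fastforce simp: z)
      ultimately show ?thesis
        using y m(1) le by (simp add: monoid_words_def)
    qed
    ultimately show "z \<in> monoid_words (Suc N)"
      by (simp add: monoid_words_def)
  qed
qed (rule finite_monoid_words)

text \<open>A word on the larger window is determined by its restriction, which is still admissible,
  and one binary letter.\<close>

lemma card_monoid_words_Suc_le:
  assumes "Suc N \<in> M"
  shows "card (monoid_words (Suc N)) \<le> 2 * card (monoid_words N)"
proof -
  let ?f = "\<lambda>y. (restrict y (M \<inter> {1..N}), y (Suc N))"
  have "card (monoid_words (Suc N)) \<le> card (monoid_words N \<times> {0, 1::nat})"
  proof (rule card_inj_on_le[where f = ?f])
    show "inj_on ?f (monoid_words (Suc N))"
    proof (rule inj_onI)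
      fix y z assume y: "y \<in> monoid_words (Suc N)" and z: "z \<in> monoid_words (Suc N)"
        and eq: "?f y = ?f z"
      show "y = z"
      proof
        fix m
        consider "m = Suc N" | "m \<in> M \<inter> {1..N}" | "m \<notin> M \<inter> {1..Suc N}"
          by (auto simp: le_Suc_eq)
        then show "y m = z m"
        proof cases
          case 1
          then show ?thesis using eq by simp
        next
          case 2
          have "restrict y (M \<inter> {1..N}) m = restrict z (M \<inter> {1..N}) m"
            using eq by simp
          then show ?thesis using 2 by simp
        next
          case 3
          have "y \<in> extensional (M \<inter> {1..Suc N})" "z \<in> extensional (M \<inter> {1..Suc N})"
            using y z by (simp_all add: monoid_words_def PiE_def)
          then have "y m = undefined" "z m = undefined"
            using 3 by (auto intro: extensional_arb)
          then show ?thesis by simp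
        qed
      qed
    qed
    show "?f ` monoid_words (Suc N) \<subseteq> monoid_words N \<times> {0, 1}"
    proof
      fix p assume "p \<in> ?f ` monoid_words (Suc N)"
      then obtain y where y: "y \<in> monoid_words (Suc N)" and p: "p = ?f y" by blast
      let ?y = "restrict y (M \<inter> {1..N})"
      have y01: "y \<in> M \<inter> {1..Suc N} \<rightarrow>\<^sub>E {0, 1}"
        using y by (simp add: monoid_words_def)
      have "?y \<in> M \<inter> {1..N} \<rightarrow>\<^sub>E {0, 1}"
        using y01 by (auto simp: PiE_iff)
      moreover have "?y m * (\<Prod>j=1..d. ?y (\<gamma> j * m)) = 0" if m: "m \<in> M" "\<gamma> d * m \<le> N" for m
      proof -
        have "?y m = y m"
          using base_mult_le(2)[OF _ m(2), of d] d_pos m(1) monoid_pos[OF m(1)] by simp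
        moreover have "(\<Prod>j=1..d. ?y (\<gamma> j * m)) = (\<Prod>j=1..d. y (\<gamma> j * m))"
        proof (intro prod.cong refl)
          fix j assume j: "j \<in> {1..d}"
          show "?y (\<gamma> j * m) = y (\<gamma> j * m)"
            using base_mult_le(1)[OF j m(2)] base_mult_in_monoid[OF j m(1)]
              monoid_pos[OF base_mult_in_monoid[OF j m(1)]] by simp
        qed
        ultimately show ?thesis
          using y m by (simp add: monoid_words_def)
      qed
      ultimately have "?y \<in> monoid_words N"
        by (simp add: monoid_words_def)
      moreover have "y (Suc N) \<in> {0, 1}"
        using assms by (intro PiE_mem[OF y01]) auto
      ultimately show "p \<in> monoid_words N \<times> {0, 1}"
        by (simp add: p)
    qed
  qed (auto intro: finite_monoid_words)
  then show ?thesis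
    by (simp add: card_cartesian_product)
qed

lemma card_monoid_words_pos: "0 < card (monoid_words N)"
proof (induction N)
  case (Suc N)
  then show ?case
    using monoid_words_Suc_notin[of N] card_monoid_words_Suc_ge[of N] by (cases "Suc N \<in> M") auto
qed (simp add: monoid_words_0)

section \<open>Logarithmic counts and their increments\<close>

definition log_words :: "nat \<Rightarrow> real" where
  "log_words N = ln (real (card (monoid_words N)))"

text \<open>Truncated subtraction makes the increment at 0 vanish, so series over all natural
  numbers may start there.\<close>

definition log_words_diff :: "nat \<Rightarrow> real" where
  "log_words_diff N = log_words N - log_words (N - 1)"

lemma log_words_0: "log_words 0 = 0"
  by (simp add: log_words_def monoid_words_0)

lemma log_words_diff_0: "log_words_diff 0 = 0"
  by (simp add: log_words_diff_def)

lemma log_words_eq_sum: "log_words N = (\<Sum>m=1..N. log_words_diff m)"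
  by (induction N) (simp_all add: log_words_0 log_words_diff_def)

lemma log_words_diff_notin:
  assumes "N \<notin> M"
  shows "log_words_diff N = 0"
  using assms monoid_words_Suc_notin[of "N - 1"]
  by (cases N) (simp_all add: log_words_diff_def log_words_def)

lemma log_words_diff_nonneg: "0 \<le> log_words_diff N"
proof (cases "N \<in> M")
  case True
  then have "card (monoid_words (N - 1)) \<le> card (monoid_words N)"
    using monoid_pos[OF True] card_monoid_words_Suc_ge[of "N - 1"] by simp
  then show ?thesis
    using card_monoid_words_pos[of "N - 1"] card_monoid_words_pos[of N]
    by (simp add: log_words_diff_def log_words_def)
qed (simp add: log_words_diff_notin)

lemma log_words_diff_le: "log_words_diff N \<le> ln 2 * indicator M N"
proof (cases "N \<in> M")
  case True
  then have "card (monoid_words N) \<le> 2 * card (monoid_words (N - 1))"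
    using monoid_pos[OF True] card_monoid_words_Suc_le[of "N - 1"] by simp
  then have "real (card (monoid_words N)) \<le> 2 * real (card (monoid_words (N - 1)))"
    by linarith
  then have "ln (real (card (monoid_words N))) \<le> ln (2 * real (card (monoid_words (N - 1))))"
    using card_monoid_words_pos[of N] card_monoid_words_pos[of "N - 1"] by (subst ln_le_cancel_iff) auto
  also have "\<dots> = ln 2 + ln (real (card (monoid_words (N - 1))))"
    using card_monoid_words_pos[of "N - 1"] by (simp add: ln_mult)
  finally show ?thesis
    using True by (simp add: log_words_diff_def log_words_def)
qed (simp add: log_words_diff_notin)

lemma log_words_nonneg: "0 \<le> log_words N"
  unfolding log_words_eq_sum by (intro sum_nonneg log_words_diff_nonneg)

text \<open>
  Working with the exponent \<open>1/2\<close> gives at once the convergence of \<open>\<Sum>\<^bsub>m \<in> M\<^esub> 1 / m\<close> and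
  the bound \<open>|M \<inter> [1, N]| = O(\<surd>N)\<close>.
\<close>

lemma sum_monoid_inverse_sqrt_le:
  "(\<Sum>m\<in>M \<inter> {..N}. 1 / sqrt (real m)) \<le> (\<Prod>j=1..d. 1 / (1 - 1 / sqrt (real (\<gamma> j))))"
proof -
  let ?E = "{1..d} \<rightarrow>\<^sub>E {..N}"
  let ?pw = "\<lambda>e. \<Prod>j=1..d. \<gamma> j ^ e j"
  have finE: "finite ?E"
    by (intro finite_PiE) auto
  \<comment> \<open>Since \<open>e j < \<gamma> j ^ e j \<le> m \<le> N\<close>, the exponents range
    over a finite box.\<close>
  have sub: "M \<inter> {..N} \<subseteq> ?pw ` ?E"
  proof
    fix m assume m: "m \<in> M \<inter> {..N}"
    then obtain e where e: "m = ?pw e"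
      unfolding mult_monoid_def by blast
    have "e j \<le> N" if j: "j \<in> {1..d}" for j
    proof -
      have "\<gamma> j ^ e j dvd m"
        unfolding e using j by (intro dvd_prodI) auto
      then have "\<gamma> j ^ e j \<le> m"
        using m monoid_pos by (auto intro: dvd_imp_le)
      moreover have "e j < \<gamma> j ^ e j"
        using base_gt_1[OF j] by (intro power_gt_expt) simp
      ultimately show ?thesis
        using m by simp
    qed
    then have "restrict e {1..d} \<in> ?E"
      by auto
    moreover have "m = ?pw (restrict e {1..d})"
      unfolding e by (intro prod.cong) auto
    ultimately show "m \<in> ?pw ` ?E" by blast
  qed
  have "(\<Sum>m\<in>M \<inter> {..N}. 1 / sqrt (real m)) \<le> (\<Sum>m\<in>?pw ` ?E. 1 / sqrt (real m))"
    by (rule sum_mono2[OF finite_imageI[OF finE] sub]) auto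
  also have "\<dots> \<le> (\<Sum>e\<in>?E. 1 / sqrt (real (?pw e)))"
    by (rule sum_image_le[OF finE, unfolded o_def]) (auto intro!: prod_nonneg)
  also have "\<dots> = (\<Sum>e\<in>?E. \<Prod>j=1..d. (1 / sqrt (real (\<gamma> j))) ^ e j)"
    by (intro sum.cong refl)
      (simp add: real_sqrt_prod real_sqrt_power prod_dividef power_divide)
  \<comment> \<open>A finite Euler product: the sum over the box factors into truncated geometric
    series.\<close>
  also have "\<dots> = (\<Prod>j=1..d. \<Sum>e\<le>N. (1 / sqrt (real (\<gamma> j))) ^ e)"
    by (rule prod_sum_PiE[symmetric]) auto
  also have "\<dots> \<le> (\<Prod>j=1..d. 1 / (1 - 1 / sqrt (real (\<gamma> j))))"
  proof (rule prod_mono)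
    fix j assume j: "j \<in> {1..d}"
    let ?x = "1 / sqrt (real (\<gamma> j))"
    have x: "0 \<le> ?x" "?x < 1"
      using base_gt_1[OF j] by (auto simp: divide_simps)
    have "(\<Sum>e\<le>N. ?x ^ e) \<le> (\<Sum>e. ?x ^ e)"
      using x by (intro sum_le_suminf summable_geometric) auto
    also have "\<dots> = 1 / (1 - ?x)"
      using x by (intro suminf_geometric) auto
    finally show "0 \<le> (\<Sum>e\<le>N. ?x ^ e) \<and> (\<Sum>e\<le>N. ?x ^ e) \<le> 1 / (1 - ?x)"
      using x by (auto intro!: sum_nonneg)
  qed
  finally show ?thesis .
qed

lemma summable_monoid_inverse_sqrt: "summable (\<lambda>N. indicator M N / sqrt (real N))"
proof (rule bounded_imp_summable)
  fix n
  have "(\<Sum>N\<le>n. indicator M N / sqrt (real N)) = (\<Sum>N\<in>M \<inter> {..n}. 1 / sqrt (real N))"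
    by (intro sum.mono_neutral_cong_right) (auto simp: indicator_def)
  then show "(\<Sum>N\<le>n. indicator M N / sqrt (real N)) \<le> (\<Prod>j=1..d. 1 / (1 - 1 / sqrt (real (\<gamma> j))))"
    using sum_monoid_inverse_sqrt_le[of n] by simp
qed simp

lemma summable_monoid_inverse: "summable (\<lambda>N. indicator M N / real N)"
proof (rule summable_comparison_test'[OF summable_monoid_inverse_sqrt, of 0])
  fix N :: nat
  have "sqrt (real N) \<le> real N" if "0 < N"
  proof -
    have "sqrt (real N) * 1 \<le> sqrt (real N) * sqrt (real N)"
      using that by (intro mult_left_mono) auto
    then show ?thesis by simp
  qed
  then show "norm (indicator M N / real N) \<le> indicator M N / sqrt (real N)"
    using monoid_pos by (auto simp: indicator_def frac_le)
qed

text \<open>This is the boundary term of the later summation by parts. There are at most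
  \<open>C * sqrt N\<close> monoid elements below \<open>N\<close>, each contributing at most
  \<open>ln 2\<close>.\<close>

lemma log_words_over_tendsto_0: "(\<lambda>N. log_words (N - 1) / real N) \<longlonglongrightarrow> 0"
proof -
  define C where "C = (\<Sum>N. indicator M N / sqrt (real N))"
  have bound: "log_words (N - 1) / real N \<le> ln 2 * C / sqrt (real N)" for N
  proof (cases "N = 0")
    case False
    have "log_words (N - 1) \<le> (\<Sum>m=1..N-1. ln 2 * indicator M m)"
      unfolding log_words_eq_sum by (intro sum_mono log_words_diff_le)
    \<comment> \<open>For \<open>m < N\<close> the weight \<open>sqrt N / sqrt m\<close> is at least
      1, which bounds the count by the convergent series \<open>C\<close>.\<close>
    also have "\<dots> \<le> (\<Sum>m=1..N-1. ln 2 * (sqrt (real N) * (indicator M m / sqrt (real m))))"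
      by (intro sum_mono mult_left_mono) (auto simp: indicator_def divide_simps)
    also have "\<dots> = ln 2 * sqrt (real N) * (\<Sum>m=1..N-1. indicator M m / sqrt (real m))"
      by (simp add: sum_distrib_left mult.assoc)
    also have "\<dots> \<le> ln 2 * sqrt (real N) * C"
      unfolding C_def by (intro mult_left_mono sum_le_suminf summable_monoid_inverse_sqrt) auto
    finally have "log_words (N - 1) / real N \<le> ln 2 * sqrt (real N) * C / real N"
      by (intro divide_right_mono) auto
    also have "\<dots> = ln 2 * C * (sqrt (real N) / real N)"
      by simp
    also have "\<dots> = ln 2 * C / sqrt (real N)"
      by (simp add: sqrt_divide_self_eq inverse_eq_divide)
    finally show ?thesis .
  qed simp
  have "filterlim (\<lambda>N. sqrt (real N)) at_top sequentially"
    by (rule filterlim_compose[OF sqrt_at_top filterlim_real_sequentially])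
  then have "(\<lambda>N. ln 2 * C / sqrt (real N)) \<longlonglongrightarrow> 0"
    by (intro tendsto_divide_0[OF tendsto_const] filterlim_at_top_imp_at_infinity)
  then show ?thesis
    by (rule tendsto_sandwich[OF _ _ tendsto_const, rotated 2])
      (use bound log_words_nonneg in simp_all)
qed

subsection \<open>Density of the independent set and the limit\<close>

definition indep_count :: "nat \<Rightarrow> nat" where
  "indep_count N = card (I \<inter> {1..N})"

lemma indep_count_le: "indep_count N \<le> N"
  unfolding indep_count_def using card_mono[of "{1..N}" "I \<inter> {1..N}"] by simp

definition period :: nat where
  "period = (\<Prod>j=1..d. \<gamma> j)"

lemma period_pos: "0 < period"
  unfolding period_def using monoid_pos[OF prod_powers_in_monoid[of "\<lambda>_. 1"]] by simp

text \<open>Every base divides \<open>period\<close>, so the shift preserves divisibility by each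
  base.\<close>

lemma indep_add_period: "0 < i \<Longrightarrow> period + i \<in> I \<longleftrightarrow> i \<in> I"
  using dvd_prodI[of "{1..d}" _ \<gamma>] by (auto simp: period_def indep_set_def dvd_add_right_iff)

lemma indep_count_add_period:
  "indep_count (period + N) = indep_count period + indep_count N"
proof -
  have "I \<inter> {1..period + N} = (I \<inter> {1..period}) \<union> (+) period ` (I \<inter> {1..N})"
  proof (intro equalityI subsetI)
    fix i assume i: "i \<in> I \<inter> {1..period + N}"
    show "i \<in> (I \<inter> {1..period}) \<union> (+) period ` (I \<inter> {1..N})"
    proof (cases "i \<le> period")
      case False
      then have "i = period + (i - period)" "i - period \<in> I \<inter> {1..N}"
        using i indep_add_period[of "i - period"] by auto
      then show ?thesis by blast
    qed (use i in auto)
  next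
    fix i assume "i \<in> (I \<inter> {1..period}) \<union> (+) period ` (I \<inter> {1..N})"
    then show "i \<in> I \<inter> {1..period + N}"
      using indep_add_period by (auto simp del: One_nat_def)
  qed
  moreover have "(I \<inter> {1..period}) \<inter> (+) period ` (I \<inter> {1..N}) = {}"
    by auto
  ultimately show ?thesis
    unfolding indep_count_def by (simp add: card_Un_disjoint card_image)
qed

lemma beta_eq: "\<beta> d \<gamma> = real (indep_count period) / real period"
  by (simp add: \<beta>_def indep_count_def period_def)

text \<open>Removing a full period lowers both terms by \<open>indep_count period\<close>. Once
  \<open>N < period\<close>, both terms lie between 0 and \<open>N\<close>.\<close>

lemma indep_count_approx:
  "\<bar>real (indep_count N) - \<beta> d \<gamma> * real N\<bar> \<le> real period"
proof (induction N rule: less_induct)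
  case (less N)
  note P = period_pos
  have beta: "\<beta> d \<gamma> * real period = real (indep_count period)" "0 \<le> \<beta> d \<gamma>" "\<beta> d \<gamma> \<le> 1"
    using P indep_count_le[of period] unfolding beta_eq by auto
  show ?case
  proof (cases "N < period")
    case True
    have "\<beta> d \<gamma> * real N \<le> 1 * real N"
      using beta by (intro mult_right_mono) auto
    moreover have "0 \<le> \<beta> d \<gamma> * real N"
      using beta by simp
    ultimately show ?thesis
      using True indep_count_le[of N] by linarith
  next
    case False
    have "real (indep_count N) = real (indep_count period) + real (indep_count (N - period))"
      using indep_count_add_period[of "N - period"] False by simp
    moreover have "\<beta> d \<gamma> * real N = real (indep_count period) + \<beta> d \<gamma> * real (N - period)"
      using False beta(1) by (simp add: algebra_simps of_nat_diff)
    ultimately show ?thesis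
      using less.IH[of "N - period"] P False by auto
  qed
qed

lemma indep_count_div_tendsto:
  "(\<lambda>n. real (indep_count (n div m)) / real n) \<longlonglongrightarrow> \<beta> d \<gamma> / real m"
proof (cases "m = 0")
  \<comment> \<open>Division by zero yields zero, so both sides vanish and the limit is available
    for every index \<open>m\<close>.\<close>
  case True
  then show ?thesis
    by (simp add: indep_count_def)
next
  case False
  have beta: "0 \<le> \<beta> d \<gamma>"
    by (simp add: beta_eq)
  \<comment> \<open>The error has two sources: at most \<open>period\<close> from the counting
    estimate, and at most \<open>\<beta> d \<gamma>\<close> from rounding \<open>n / m\<close>
    down.\<close>
  have bound: "norm (real (indep_count (n div m)) / real n - \<beta> d \<gamma> / real m) \<le> (real period + \<beta> d \<gamma>) / real n"
    if "0 < n" for n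
  proof -
    have "real n / real m - 1 \<le> real (n div m)" "real (n div m) \<le> real n / real m"
      using floor_correct[of "real n / real m"] by (simp_all add: floor_divide_of_nat_eq)
    then have "\<bar>\<beta> d \<gamma> * (real (n div m) - real n / real m)\<bar> \<le> \<beta> d \<gamma> * 1"
      unfolding abs_mult using beta by (intro mult_mono) auto
    then have "\<bar>real (indep_count (n div m)) - \<beta> d \<gamma> * (real n / real m)\<bar> \<le> real period + \<beta> d \<gamma>"
      using indep_count_approx[of "n div m"] by (simp add: right_diff_distrib)
    then have "\<bar>real (indep_count (n div m)) - \<beta> d \<gamma> * (real n / real m)\<bar> / real n \<le> (real period + \<beta> d \<gamma>) / real n"
      by (intro divide_right_mono) auto
    moreover have "real (indep_count (n div m)) / real n - \<beta> d \<gamma> / real m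
      = (real (indep_count (n div m)) - \<beta> d \<gamma> * (real n / real m)) / real n"
      using that by (simp add: diff_divide_distrib)
    ultimately show ?thesis
      by (simp add: abs_divide)
  qed
  have "(\<lambda>n. real (indep_count (n div m)) / real n - \<beta> d \<gamma> / real m) \<longlonglongrightarrow> 0"
    by (rule Lim_null_comparison[OF _ lim_const_over_n[of "real period + \<beta> d \<gamma>"]])
      (use bound in \<open>auto intro: eventually_sequentiallyI[of 1] \<close>)
  then show ?thesis
    by (rule LIM_zero_cancel)
qed

text \<open>Telescoping each \<open>log_words (n div i)\<close> gives a sum over pairs with
  \<open>i * m \<le> n\<close>; for fixed \<open>m\<close>, the number of admissible
  \<open>i\<close> is \<open>indep_count (n div m)\<close>.\<close>

lemma entropy_seq_eq_suminf:
  "entropy_seq d \<gamma> n = (\<Sum>m. log_words_diff m * (real (indep_count (n div m)) / real n))"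
proof -
  have "ln (real (card (mult_words d \<gamma> n))) = (\<Sum>i\<in>I \<inter> {1..n}. log_words (n div i))"
    unfolding card_mult_words of_nat_prod log_words_def
    by (rule ln_prod) (use card_monoid_words_pos in auto)
  \<comment> \<open>Filtering the fixed range \<open>{1..n}\<close> by \<open>i * m \<le> n\<close>
    prepares the exchange of sums.\<close>
  also have "\<dots> = (\<Sum>i\<in>I \<inter> {1..n}. \<Sum>m\<in>{m\<in>{1..n}. i * m \<le> n}. log_words_diff m)"
  proof (intro sum.cong refl)
    fix i assume i: "i \<in> I \<inter> {1..n}"
    have "m \<le> n" if "i * m \<le> n" for m
      using i by (intro order_trans[OF _ that]) simp
    then have "{m\<in>{1..n}. i * m \<le> n} = {1..n div i}"
      using i by (auto simp: less_eq_div_iff_mult_less_eq mult.commute)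
    then show "log_words (n div i) = (\<Sum>m\<in>{m\<in>{1..n}. i * m \<le> n}. log_words_diff m)"
      by (simp add: log_words_eq_sum)
  qed
  also have "\<dots> = (\<Sum>m=1..n. \<Sum>i\<in>{i\<in>I \<inter> {1..n}. i * m \<le> n}. log_words_diff m)"
    by (rule sum.swap_restrict) auto
  also have "\<dots> = (\<Sum>m=1..n. log_words_diff m * real (indep_count (n div m)))"
  proof (intro sum.cong refl)
    fix m assume m: "m \<in> {1..n}"
    have "i \<le> n" if "i * m \<le> n" for i
      using m by (intro order_trans[OF _ that]) simp
    then have "{i\<in>I \<inter> {1..n}. i * m \<le> n} = I \<inter> {1..n div m}"
      using m by (auto simp: less_eq_div_iff_mult_less_eq)
    then show "(\<Sum>i\<in>{i\<in>I \<inter> {1..n}. i * m \<le> n}. log_words_diff m)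
        = log_words_diff m * real (indep_count (n div m))"
      by (simp add: indep_count_def mult.commute)
  qed
  finally have "entropy_seq d \<gamma> n
      = (\<Sum>m=1..n. log_words_diff m * (real (indep_count (n div m)) / real n))"
    by (simp add: entropy_seq_def sum_divide_distrib)
  \<comment> \<open>Terms with \<open>m > n\<close> vanish because \<open>n div m = 0\<close>. An
    index range free of \<open>n\<close> is what dominated convergence requires.\<close>
  also have "\<dots> = (\<Sum>m. log_words_diff m * (real (indep_count (n div m)) / real n))"
  proof (rule suminf_finite[symmetric])
    fix m assume "m \<notin> {1..n}"
    then have "m = 0 \<or> n div m = 0" by auto
    then show "log_words_diff m * (real (indep_count (n div m)) / real n) = 0"
      by (auto simp: log_words_diff_0 indep_count_def)
  qed simp
  finally show ?thesis .
qed

lemma entropy_seq_tendsto: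
  "summable (\<lambda>m. log_words_diff m * (\<beta> d \<gamma> / real m))"
  "entropy_seq d \<gamma> \<longlonglongrightarrow> (\<Sum>m. log_words_diff m * (\<beta> d \<gamma> / real m))"
proof -
  \<comment> \<open>Increments live on the monoid and are at most \<open>ln 2\<close>, and the
    relative count is at most \<open>1 / m\<close>; this majorant is summable and independent of
    \<open>n\<close>.\<close>
  have bound: "norm (log_words_diff m * (real (indep_count (n div m)) / real n))
      \<le> ln 2 * (indicator M m / real m)" for m n
  proof (cases "m = 0 \<or> n = 0")
    case True
    then show ?thesis by (auto simp: log_words_diff_0)
  next
    case False
    have "real (indep_count (n div m)) \<le> real (n div m)"
      using indep_count_le by simp
    also have "\<dots> \<le> real n / real m"
      by (rule of_nat_div_le_of_nat)
    finally have "real (indep_count (n div m)) / real n \<le> 1 / real m"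
      using False by (simp add: field_simps)
    then have "log_words_diff m * (real (indep_count (n div m)) / real n)
        \<le> ln 2 * indicator M m * (1 / real m)"
      by (intro mult_mono log_words_diff_le) auto
    then show ?thesis
      using log_words_diff_nonneg[of m] by (simp add: abs_mult)
  qed
  have *: "eventually (\<lambda>n. summable (\<lambda>m. norm (log_words_diff m * (real (indep_count (n div m)) / real n)))) sequentially \<and>
    summable (\<lambda>m. norm (log_words_diff m * (\<beta> d \<gamma> / real m))) \<and>
    (\<lambda>n. \<Sum>m. log_words_diff m * (real (indep_count (n div m)) / real n))
      \<longlonglongrightarrow> (\<Sum>m. log_words_diff m * (\<beta> d \<gamma> / real m))"
    by (rule tannerys_theorem[where M = "\<lambda>m. ln 2 * (indicator M m / real m)"])
      (use bound in \<open>auto intro!: tendsto_mult tendsto_const indep_count_div_tendsto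
        summable_mult summable_monoid_inverse always_eventually simp del: times_divide_eq_right\<close>)
  show "summable (\<lambda>m. log_words_diff m * (\<beta> d \<gamma> / real m))"
    by (rule summable_norm_cancel[OF *[THEN conjunct2, THEN conjunct1]])
  show "entropy_seq d \<gamma> \<longlonglongrightarrow> (\<Sum>m. log_words_diff m * (\<beta> d \<gamma> / real m))"
    unfolding entropy_seq_eq_suminf by (rule *[THEN conjunct2, THEN conjunct2])
qed

subsection \<open>Admissible patterns as words on the monoid\<close>

text \<open>The conversion \<open>nat\<close> sends negative coordinates to 0, so this is a faithful
  code only on the nonnegative orthant.\<close>

definition lattice_value :: "(nat \<Rightarrow> int) \<Rightarrow> nat" where
  "lattice_value i = (\<Prod>j=1..d. \<gamma> j ^ nat (i j))"

lemma simplex_region_eq: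
  "simplex_region d \<gamma> k =
     {i \<in> Zd d. (\<forall>j\<in>{1..d}. 0 \<le> i j) \<and> lattice_value i \<le> q d \<gamma> k}"
  by (simp add: simplex_region_def lattice_value_def)

lemma lattice_value_increment:
  assumes "j \<in> {1..d}" "\<And>i. i \<in> {1..d} \<Longrightarrow> 0 \<le> v i"
  shows "lattice_value (increment d v j) = \<gamma> j * lattice_value v"
proof -
  have "lattice_value (increment d v j) = (\<Prod>i=1..d. \<gamma> i ^ (nat (v i) + of_bool (i = j)))"
    unfolding lattice_value_def using assms(2)
    by (intro prod.cong refl) (auto simp: increment_def nat_add_distrib)
  then show ?thesis
    using prod_powers_increment[OF assms(1)] by (simp add: lattice_value_def)
qed

text \<open>Injectivity is uniqueness of exponents; surjectivity takes the exponent vector of a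
  monoid element as a lattice point.\<close>

lemma bij_betw_lattice_value:
  "bij_betw lattice_value (simplex_region d \<gamma> k) (M \<inter> {1..q d \<gamma> k})"
  unfolding bij_betw_def
proof (intro conjI equalityI subsetI)
  show "inj_on lattice_value (simplex_region d \<gamma> k)"
  proof (rule inj_onI)
    fix u v assume uv: "u \<in> simplex_region d \<gamma> k" "v \<in> simplex_region d \<gamma> k"
      and eq: "lattice_value u = lattice_value v"
    show "u = v"
    proof (rule extensionalityI[of _ "{1..d}"])
      show "u \<in> extensional {1..d}" "v \<in> extensional {1..d}"
        using uv by (auto simp: simplex_region_eq Zd_def PiE_def)
      fix j assume j: "j \<in> {1..d}"
      have "nat (u j) = nat (v j)"
        using prod_powers_inj[OF eq[unfolded lattice_value_def] j] .
      moreover have "0 \<le> u j" "0 \<le> v j"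
        using uv j by (auto simp: simplex_region_eq)
      ultimately show "u j = v j" by simp
    qed
  qed
next
  fix m assume "m \<in> lattice_value ` simplex_region d \<gamma> k"
  then obtain u where u: "u \<in> simplex_region d \<gamma> k" "m = lattice_value u" by blast
  then have "m \<in> M"
    using prod_powers_in_monoid by (simp add: lattice_value_def)
  then show "m \<in> M \<inter> {1..q d \<gamma> k}"
    using u monoid_pos[of m] by (simp add: simplex_region_eq Suc_le_eq)
next
  fix m assume m: "m \<in> M \<inter> {1..q d \<gamma> k}"
  then obtain e where e: "m = (\<Prod>j=1..d. \<gamma> j ^ e j)"
    unfolding mult_monoid_def by blast
  let ?u = "\<lambda>j\<in>{1..d}. int (e j)"
  have "m = lattice_value ?u"
    unfolding e lattice_value_def by (intro prod.cong) auto
  moreover from this have "?u \<in> simplex_region d \<gamma> k"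
    using m by (auto simp: simplex_region_eq Zd_def)
  ultimately show "m \<in> lattice_value ` simplex_region d \<gamma> k" by blast
qed

text \<open>Under \<open>lattice_value\<close> the corner at \<open>v\<close> becomes
  \<open>m\<close> together with all \<open>\<gamma> j * m\<close>, and it fits in the region
  exactly when \<open>\<gamma> d * m \<le> N\<close>. A product of binary letters vanishes exactly
  when they are not all 1.\<close>

lemma card_admissible_patterns:
  "card (admissible_patterns d \<gamma> k) = card (monoid_words (q d \<gamma> k))"
proof -
  define N where "N = q d \<gamma> k"
  define R where "R = simplex_region d \<gamma> k"
  let ?F = "\<lambda>y. \<lambda>i\<in>R. y (lattice_value i)"
  have bij: "bij_betw lattice_value R (M \<inter> {1..N})"
    unfolding R_def N_def by (rule bij_betw_lattice_value)
  have incr_value: "lattice_value (increment d v j) = \<gamma> j * lattice_value v"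
    if "v \<in> R" "j \<in> {1..d}" for v j
    using that by (intro lattice_value_increment) (auto simp: R_def simplex_region_eq)
  have iff: "(\<forall>v\<in>Zd d. translate d v (corner d) \<subseteq> R \<longrightarrow> \<not> (\<forall>i\<in>translate d v (corner d). ?F y i = 1))
      \<longleftrightarrow> (\<forall>m\<in>M. \<gamma> d * m \<le> N \<longrightarrow> y m * (\<Prod>j=1..d. y (\<gamma> j * m)) = 0)" (is "?A \<longleftrightarrow> ?B")
    if y: "y \<in> M \<inter> {1..N} \<rightarrow>\<^sub>E {0, 1}" for y :: "nat \<Rightarrow> nat"
  proof
    assume ?A
    show ?B
    proof (intro ballI impI)
      fix m assume m: "m \<in> M" "\<gamma> d * m \<le> N"
      have "m \<in> M \<inter> {1..N}"
        using m base_mult_le(2)[OF _ m(2), of d] d_pos monoid_pos[OF m(1)] by auto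
      then obtain v where v: "v \<in> R" "m = lattice_value v"
        using bij unfolding bij_betw_def by blast
      have vZ: "v \<in> Zd d"
        using v(1) by (auto simp: R_def simplex_region_eq)
      have incr: "increment d v j \<in> R" if j: "j \<in> {1..d}" for j
      proof -
        have "lattice_value (increment d v j) \<le> N"
          using base_mult_le(1)[OF j m(2)] incr_value[OF v(1) j] v(2) by simp
        moreover have "increment d v j \<in> Zd d"
          by (simp add: increment_def Zd_def)
        moreover have "0 \<le> increment d v j i" if "i \<in> {1..d}" for i
          using v(1) that by (simp add: increment_def R_def simplex_region_eq)
        ultimately show ?thesis
          by (simp add: R_def N_def simplex_region_eq)
      qed
      have "translate d v (corner d) \<subseteq> R"
        using v(1) incr by (auto simp: translate_corner[OF vZ])
      then obtain i where i: "i \<in> insert v (increment d v ` {1..d})" "?F y i \<noteq> 1"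
        using \<open>?A\<close> vZ unfolding translate_corner[OF vZ, symmetric] by blast
      have iR: "i \<in> R"
        using i(1) v(1) incr by auto
      then have "lattice_value i \<in> M \<inter> {1..N}"
        using bij by (auto simp: bij_betw_def)
      then have zero: "y (lattice_value i) = 0"
        using PiE_mem[OF y] i(2) iR by force
      consider "i = v" | j where "j \<in> {1..d}" "i = increment d v j"
        using i(1) by blast
      then show "y m * (\<Prod>j=1..d. y (\<gamma> j * m)) = 0"
      proof cases
        case 1
        then show ?thesis using zero v(2) by simp
      next
        case 2
        then have "(\<Prod>j=1..d. y (\<gamma> j * m)) = 0"
          using zero v incr_value by (intro prod_zero bexI[of _ j]) auto
        then show ?thesis by simp
      qed
    qed
  next
    assume ?B
    show ?A
    proof (intro ballI impI notI)
      fix v assume vZ: "v \<in> Zd d" and sub: "translate d v (corner d) \<subseteq> R"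
        and ones: "\<forall>i\<in>translate d v (corner d). ?F y i = 1"
      note tc = translate_corner[OF vZ]
      \<comment> \<open>The corner contains the origin, so \<open>v\<close> itself lies in
        \<open>R\<close> and has nonnegative coordinates.\<close>
      have vR: "v \<in> R"
        using sub by (simp add: tc)
      have incr: "increment d v j \<in> R" if "j \<in> {1..d}" for j
        using sub that by (auto simp: tc)
      have "y (lattice_value v) = 1"
        using ones vR by (simp add: tc)
      moreover have "y (\<gamma> j * lattice_value v) = 1" if "j \<in> {1..d}" for j
      proof -
        have "?F y (increment d v j) = 1"
          using ones that unfolding tc by blast
        then show ?thesis
          using incr[OF that] incr_value[OF vR that] by simp
      qed
      ultimately have "y (lattice_value v) * (\<Prod>j=1..d. y (\<gamma> j * lattice_value v)) = 1"
        by (simp del: One_nat_def)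
      moreover have "lattice_value v \<in> M"
        using prod_powers_in_monoid by (simp add: lattice_value_def)
      \<comment> \<open>The increment in direction \<open>d\<close> lies in \<open>R\<close>, which
        activates the constraint at \<open>lattice_value v\<close>.\<close>
      moreover have "\<gamma> d * lattice_value v \<le> N"
        using incr[of d] incr_value[OF vR, of d] d_pos by (auto simp: R_def N_def simplex_region_eq)
      ultimately show False
        using \<open>?B\<close> by (metis zero_neq_one)
    qed
  qed
  have "bij_betw ?F (monoid_words N) (admissible_patterns d \<gamma> k)"
    unfolding monoid_words_def admissible_patterns_def R_def[symmetric]
    by (rule bij_betw_Collect[OF bij_betw_PiE_compose[OF bij]]) (use iff in blast)
  then show ?thesis
    unfolding N_def by (rule bij_betw_same_card[symmetric])
qed

subsection \<open>Summation by parts\<close>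

text \<open>The count can change only at elements of the monoid.\<close>

lemma log_words_eq_of_gap:
  assumes "K \<le> N" "\<And>m. m \<in> M \<Longrightarrow> K < m \<Longrightarrow> N < m"
  shows "log_words N = log_words K"
  using assms
proof (induction N rule: dec_induct)
  case (step N)
  have "Suc N \<notin> M"
    using step.prems[of "Suc N"] step.hyps by auto
  then have "log_words (Suc N) = log_words N"
    using log_words_diff_notin[of "Suc N"] by (simp add: log_words_diff_def)
  moreover have "log_words N = log_words K"
    using step.prems by (intro step.IH) force
  ultimately show ?case by simp
qed simp

text \<open>The index shift: \<open>q\<close> counts from 1 and \<open>enumerate\<close> from 0, so
  summand \<open>k\<close> below is the one numbered \<open>k + 1\<close> in the series.\<close>

lemma q_Suc: "q d \<gamma> (Suc k) = enumerate M k"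
  by (simp add: q_def)

lemma enumerate_monoid_gap:
  assumes "m \<in> M" "enumerate M k < m"
  shows "enumerate M (Suc k) \<le> m"
  unfolding enumerate_Suc''[OF infinite_monoid] using assms by (intro Least_le) simp

lemma enumerate_monoid_0: "enumerate M 0 = 1"
  unfolding enumerate_0
  by (rule Least_equality) (use one_in_monoid monoid_pos in \<open>auto simp: Suc_le_eq\<close>)

text \<open>Summation by parts. The right-hand sum stops just before element \<open>K\<close> of the
  enumeration, hence the argument \<open>enumerate M K - 1\<close> in the boundary term.\<close>

lemma abel_summation_monoid:
  "(\<Sum>k<K. (1 / real (enumerate M k) - 1 / real (enumerate M (Suc k))) * log_words (enumerate M k))
    = (\<Sum>m<enumerate M K. log_words_diff m / real m)
      - log_words (enumerate M K - 1) / real (enumerate M K)"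
proof (induction K)
  case 0
  then show ?case
    by (simp add: enumerate_monoid_0 log_words_0)
next
  case (Suc K)
  define e e' where "e = enumerate M K" and "e' = enumerate M (Suc K)"
  have e: "e \<in> M" "e' \<in> M" "e < e'"
    unfolding e_def e'_def using infinite_monoid by (auto intro: enumerate_in_set enumerate_step)
  have gap: "e' \<le> m" if "m \<in> M" "e < m" for m
    using enumerate_monoid_gap that unfolding e_def e'_def by blast
  \<comment> \<open>No monoid element lies strictly between \<open>e\<close> and \<open>e'\<close>,
    so the new boundary value is the value at \<open>e\<close>.\<close>
  have "log_words (e' - 1) = log_words e"
    using e gap by (intro log_words_eq_of_gap) (auto simp: less_le_trans[of _ e'])
  moreover have "(\<Sum>m<e'. log_words_diff m / real m) = (\<Sum>m<e. log_words_diff m / real m) + log_words_diff e / real e"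
  proof -
    have "(\<Sum>m<e'. log_words_diff m / real m) = (\<Sum>m<Suc e. log_words_diff m / real m)"
    proof (intro sum.mono_neutral_right ballI)
      fix m assume "m \<in> {..<e'} - {..<Suc e}"
      then have "m \<notin> M"
        using gap[of m] by auto
      then show "log_words_diff m / real m = 0"
        by (simp add: log_words_diff_notin)
    qed (use e in auto)
    then show ?thesis by simp
  qed
  moreover have "log_words_diff e = log_words e - log_words (e - 1)"
    by (simp add: log_words_diff_def)
  ultimately show ?case
    using Suc unfolding e_def[symmetric] e'_def[symmetric] sum.lessThan_Suc
    by (simp add: algebra_simps diff_divide_distrib)
qed

text \<open>The partial sums of the stated series are, by summation by parts, partial sums of the
  limit series cut off at \<open>enumerate M K\<close>, minus a boundary term that tends to
  0.\<close>

lemma entropy_formula: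
  "convergent (entropy_seq d \<gamma>)"
  "(\<lambda>k. \<beta> d \<gamma> * (1 / real (q d \<gamma> (Suc k)) - 1 / real (q d \<gamma> (Suc k + 1)))
      * ln (real (card (admissible_patterns d \<gamma> (Suc k))))) sums entropy d \<gamma>"
proof -
  let ?h = "\<Sum>m. log_words_diff m * (\<beta> d \<gamma> / real m)"
  show "convergent (entropy_seq d \<gamma>)"
    using entropy_seq_tendsto(2) by (rule convergentI)
  have h: "entropy d \<gamma> = ?h"
    unfolding entropy_def using entropy_seq_tendsto(2) by (rule limI)
  have e_lim: "filterlim (enumerate M) at_top sequentially"
    using infinite_monoid by (intro filterlim_subseq) (simp add: strict_mono_def)
  have "(\<lambda>N. \<Sum>m<N. log_words_diff m * (\<beta> d \<gamma> / real m)) \<longlonglongrightarrow> ?h"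
    using summable_sums[OF entropy_seq_tendsto(1)] by (simp add: sums_def)
  then have "(\<lambda>N. (\<Sum>m<N. log_words_diff m * (\<beta> d \<gamma> / real m))
      - \<beta> d \<gamma> * (log_words (N - 1) / real N)) \<longlonglongrightarrow> ?h - \<beta> d \<gamma> * 0"
    by (intro tendsto_diff tendsto_mult tendsto_const log_words_over_tendsto_0)
  \<comment> \<open>Only cutoffs at monoid elements matter, and these tend to infinity.\<close>
  from filterlim_compose[OF this e_lim]
  have lim: "(\<lambda>K. (\<Sum>m<enumerate M K. log_words_diff m * (\<beta> d \<gamma> / real m))
      - \<beta> d \<gamma> * (log_words (enumerate M K - 1) / real (enumerate M K))) \<longlonglongrightarrow> ?h"
    by simp
  have partial: "(\<Sum>k<K. \<beta> d \<gamma> * (1 / real (q d \<gamma> (Suc k)) - 1 / real (q d \<gamma> (Suc k + 1)))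
      * ln (real (card (admissible_patterns d \<gamma> (Suc k)))))
    = (\<Sum>m<enumerate M K. log_words_diff m * (\<beta> d \<gamma> / real m))
      - \<beta> d \<gamma> * (log_words (enumerate M K - 1) / real (enumerate M K))" (is "?L = ?R") for K
  proof -
    have "?L = \<beta> d \<gamma> * (\<Sum>k<K. (1 / real (enumerate M k) - 1 / real (enumerate M (Suc k)))
        * log_words (enumerate M k))"
      unfolding sum_distrib_left card_admissible_patterns Suc_eq_plus1[symmetric] q_Suc log_words_def
      by (simp only: mult.assoc)
    also have "\<dots> = \<beta> d \<gamma> * (\<Sum>m<enumerate M K. log_words_diff m / real m)
      - \<beta> d \<gamma> * (log_words (enumerate M K - 1) / real (enumerate M K))"
      unfolding abel_summation_monoid by (rule right_diff_distrib)
    also have "\<beta> d \<gamma> * (\<Sum>m<enumerate M K. log_words_diff m / real m)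
      = (\<Sum>m<enumerate M K. log_words_diff m * (\<beta> d \<gamma> / real m))"
      unfolding sum_distrib_left by (intro sum.cong) (simp_all add: mult.commute)
    finally show ?thesis .
  qed
  show "(\<lambda>k. \<beta> d \<gamma> * (1 / real (q d \<gamma> (Suc k)) - 1 / real (q d \<gamma> (Suc k + 1)))
      * ln (real (card (admissible_patterns d \<gamma> (Suc k))))) sums entropy d \<gamma>"
    unfolding sums_def h partial by (rule lim)
qed

end

theorem theorem1p3:
  fixes d :: nat and \<gamma> :: "nat \<Rightarrow> nat"
  assumes "d \<ge> 2"
    and "1 < \<gamma> 1"
    and "\<And>i j. 1 \<le> i \<Longrightarrow> i < j \<Longrightarrow> j \<le> d \<Longrightarrow> \<gamma> i < \<gamma> j"
    and "\<And>i j. 1 \<le> i \<Longrightarrow> i < j \<Longrightarrow> j \<le> d \<Longrightarrow> gcd (\<gamma> i) (\<gamma> j) = 1"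
  shows "convergent (entropy_seq d \<gamma>) \<and>
    (\<lambda>k. \<beta> d \<gamma> * (1 / real (q d \<gamma> (Suc k)) - 1 / real (q d \<gamma> (Suc k + 1)))
           * ln (real (card (admissible_patterns d \<gamma> (Suc k))))) sums entropy d \<gamma>"
proof -
  \<comment> \<open>Strict monotonicity makes every base exceed 1, as \<open>\<gamma> 1\<close>
    does, and makes \<open>\<gamma> d\<close> the largest.\<close>
  interpret coprime_bases d \<gamma>
  proof
    show "1 \<le> d"
      using assms(1) by simp
    fix j assume j: "j \<in> {1..d}"
    show "1 < \<gamma> j"
      using assms(2) assms(3)[of 1 j] j by (cases "j = 1") auto
    show "\<gamma> j \<le> \<gamma> d"
      using assms(3)[of j d] j by (cases "j = d") auto
  next
    fix i j assume "i \<in> {1..d}" "j \<in> {1..d}" "i \<noteq> j"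
    then show "coprime (\<gamma> i) (\<gamma> j)"
      using assms(4)[of i j] assms(4)[of j i]
      by (cases "i < j") (auto simp: coprime_iff_gcd_eq_1 gcd.commute)
  qed
  show ?thesis
    using entropy_formula by blast
qed

end
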